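(* Let $\psi(\eta)$ be a real-valued functional of the parameter, $\eta_0$ the true parameter, $\delta\in(0,1)$ and $V>0$. Suppose that for some $0<\alpha_n<1$ with $n\alpha_n\to\infty$ and some centering $\hat\psi=\hat\psi(Y^n)$ that is linear efficient, with $V$ the efficiency bound for estimating $\psi(\eta)$: the $\alpha_n$-posterior distribution of $\sqrt{n\alpha_n}(\psi(\eta)-\hat\psi)$ converges weakly in $P_0$-probability to $\mathcal N(0,V)$, and $\sqrt n(\hat\psi-\psi(\eta_0))$ converges in distribution to $\mathcal N(0,V)$ under $P_0$. For $u\in(0,1)$ let $a^Y_{n,u}$ be the $u$-quantile of the $\alpha_n$-posterior distribution of $\psi(\eta)$. Let $\bar\psi$ be an estimator of $\psi(\eta_0)$ built from the $\alpha_n$-posterior distribution of $\psi(\eta)$ and satisfying $$\bar\psi=\hat\psi+o_P(1/\sqrt n).\qquad(\ast)$$ Then $$\mathcal J_{\alpha_n}=\Big(\sqrt{\alpha_n}\,(a^Y_{n,\delta/2}-\bar\psi)+\bar\psi\,,\ \sqrt{\alpha_n}\,(a^Y_{n,1-\delta/2}-\bar\psi)+\bar\psi\Big]$$ is an asymptotically efficient confidence interval of level $1-\delta$ for $\psi(\eta_0)$, i.e. $$P_0\big[\psi(\eta_0)\in\mathcal J_{\alpha_n}\big]\to1-\delta\qquad(n\to\infty).$$ If $\alpha_n=\alpha\in(0,1]$ is fixed, the $\alpha$-posterior distribution of $\sqrt{n\alpha}(\psi(\eta)-\hat\psi)$ converges weakly in $P_0$-probability to $\mathcal N(0,V)$,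 $\sqrt n(\hat\psi-\psi(\eta_0))$ converges in distribution to $\mathcal N(0,V)$ under $P_0$, and $\bar\psi$ is the $\alpha$-posterior median $a^Y_{n,1/2}$, then $(\ast)$ holds; in particular $\mathcal J_\alpha$ is an asymptotically efficient confidence interval of level $1-\delta$ for $\psi(\eta_0)$.
   Context: $(P^n_\eta:\eta\in S)$ is a sequence of dominated statistical experiments with observation $Y=Y^n$ and log-likelihood $\ell_n(\eta)$; $P_0=P^n_{\eta_0}$ and $o_P$ is in $P_0$-probability. For a prior $\Pi$ the $\alpha_n$-posterior is $\Pi_{\alpha_n}(B\mid Y^n)=\int_Be^{\alpha_n\ell_n}d\Pi/\int e^{\alpha_n\ell_n}d\Pi$, and the $\alpha_n$-posterior distribution of a function of $\eta$ is the push-forward of $\Pi_{\alpha_n}(\cdot\mid Y^n)$ by that function. A data-dependent law $Q_Y$ on $\mathbb R$ converges weakly in $P_0$-probability to $\mathcal N(0,V)$ if $d_{BL}(Q_Y,\mathcal N(0,V))\to0$ in $P_0$-probability, with $d_{BL}$ the bounded Lipschitz distance. Quantiles are generalised quantiles if the distribution function is not continuous. "Linear efficient, with efficiency bound $V$" refers to the following setting. The log-likelihood admits a LAN expansion around $\eta_0$, $\ell_n(\eta)=\ell_n(\eta_0)-\frac n2\|\eta-\eta_0\|_L^2+\sqrt n\,W_n(\eta-\eta_0)+R_n(\eta,\eta_0)$, for a Hilbert norm $\|\cdot\|_L$ on a space $\mathcal H$ and a linear map $W_n$ with $W_n(h)$ converging weakly to $\mathcal N(0,\|h\|_L^2)$.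 The functional expands as $\psi(\eta)-\psi(\eta_0)=\langle\psi_0,\eta-\eta_0\rangle_L+r(\eta,\eta_0)$ with $\psi_0\in\mathcal H$. Then $V=\|\psi_0\|_L^2$, and $\hat\psi$ is linear efficient if $\hat\psi=\psi(\eta_0)+W_n(\psi_0)/\sqrt n+o_P(1/\sqrt n)$. The property of $\hat\psi$ and $V$ expressed by the displayed convergence $\sqrt n(\hat\psi-\psi(\eta_0))\to\mathcal N(0,V)$ follows from this. *)

theory Defs
  imports "HOL-Probability.Probability"
begin

section \<open>Convergence of laws and of random variables\<close>

text \<open>Outer measure is used because \<^const>\<open>measure\<close> is 0 on non-measurable sets, which would make
  the condition vacuous for non-measurable \<open>X n\<close>; for measurable \<open>X n\<close> this is ordinary
  convergence in probability.\<close>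

definition tendsto_zero_in_prob :: "(nat \<Rightarrow> 'y measure) \<Rightarrow> (nat \<Rightarrow> 'y \<Rightarrow> real) \<Rightarrow> bool" where
  "tendsto_zero_in_prob M X \<longleftrightarrow>
     (\<forall>\<epsilon>>0. (\<lambda>n. outer_measure_of (M n) {y \<in> space (M n). \<bar>X n y\<bar> > \<epsilon>}) \<longlonglongrightarrow> 0)"

text \<open>\<open>X n = o\<^sub>P(1 / sqrt n)\<close>\<close>

definition small_o_P_root_n :: "(nat \<Rightarrow> 'y measure) \<Rightarrow> (nat \<Rightarrow> 'y \<Rightarrow> real) \<Rightarrow> bool" where
  "small_o_P_root_n M X \<longleftrightarrow> tendsto_zero_in_prob M (\<lambda>n y. sqrt (real n) * X n y)"

text \<open>The normal law with mean 0 and variance \<open>v\<close>; \<^const>\<open>normal_density\<close> is not a density for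
  variance 0, where the law is the Dirac mass at 0.\<close>

definition centered_normal :: "real \<Rightarrow> real measure" where
  "centered_normal v =
     (if v = 0 then return borel 0 else density lborel (normal_density 0 (sqrt v)))"

definition bounded_lipschitz_dist :: "real measure \<Rightarrow> real measure \<Rightarrow> real" where
  "bounded_lipschitz_dist Q Q' =
     (SUP f \<in> {f. 1-lipschitz_on UNIV f \<and> (\<forall>x. \<bar>f x\<bar> \<le> 1)}. \<bar>(LINT x|Q. f x) - (LINT x|Q'. f x)\<bar>)"

definition weak_conv_in_prob :: "(nat \<Rightarrow> 'y measure) \<Rightarrow> (nat \<Rightarrow> 'y \<Rightarrow> real measure) \<Rightarrow> real measure \<Rightarrow> bool" where
  "weak_conv_in_prob M Q N \<longleftrightarrow> tendsto_zero_in_prob M (\<lambda>n y. bounded_lipschitz_dist (Q n y) N)"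

definition quantile :: "real measure \<Rightarrow> real \<Rightarrow> real" where
  "quantile Q u = Inf {x. u \<le> cdf Q x}"


section \<open>Dominated experiments and fractional posteriors\<close>

definition dominated_experiments ::
    "'e set \<Rightarrow> (nat \<Rightarrow> 'e \<Rightarrow> 'y measure) \<Rightarrow> (nat \<Rightarrow> 'y measure) \<Rightarrow> (nat \<Rightarrow> 'e \<Rightarrow> 'y \<Rightarrow> real) \<Rightarrow> bool" where
  "dominated_experiments S P \<mu> p \<longleftrightarrow>
     (\<forall>n. sigma_finite_measure (\<mu> n) \<and>
          (\<forall>\<eta>\<in>S. p n \<eta> \<in> borel_measurable (\<mu> n) \<and> (\<forall>y \<in> space (\<mu> n). 0 \<le> p n \<eta> y) \<and>
                 P n \<eta> = density (\<mu> n) (\<lambda>y. ennreal (p n \<eta> y)) \<and> prob_space (P n \<eta>)))"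

text \<open>The log-likelihood is \<open>-\<infinity>\<close> where the density vanishes; the real-valued \<^const>\<open>ln\<close> would give
  \<open>ln 0 = 0\<close> there.\<close>

definition log_lik :: "(nat \<Rightarrow> 'e \<Rightarrow> 'y \<Rightarrow> real) \<Rightarrow> nat \<Rightarrow> 'e \<Rightarrow> 'y \<Rightarrow> ereal" where
  "log_lik p n \<eta> y = (if p n \<eta> y > 0 then ereal (ln (p n \<eta> y)) else -\<infinity>)"

text \<open>\<open>exp (a * l)\<close> for \<open>l < \<infinity>\<close> and \<open>a > 0\<close>\<close>

definition exp_mult :: "real \<Rightarrow> ereal \<Rightarrow> ennreal" where
  "exp_mult a l = (if l = -\<infinity> then 0 else ennreal (exp (a * real_of_ereal l)))"

text \<open>The posterior assigns to \<open>B\<close> the mass \<open>(\<integral>\<^sub>B exp (a * l) d prior) / (\<integral> exp (a * l) d prior)\<close>.  Where the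
  denominator is 0 or \<open>\<infinity>\<close> this is the null measure, which has bounded Lipschitz distance 1 from
  every probability measure.\<close>

definition frac_posterior :: "'e measure \<Rightarrow> real \<Rightarrow> ('e \<Rightarrow> ereal) \<Rightarrow> 'e measure" where
  "frac_posterior prior a l =
     scale_measure (1 / (\<integral>\<^sup>+\<eta>. exp_mult a (l \<eta>) \<partial>prior)) (density prior (\<lambda>\<eta>. exp_mult a (l \<eta>)))"

definition posterior_law ::
    "(nat \<Rightarrow> 'e \<Rightarrow> 'y \<Rightarrow> real) \<Rightarrow> (nat \<Rightarrow> 'e measure) \<Rightarrow> (nat \<Rightarrow> real) \<Rightarrow> nat \<Rightarrow> 'y \<Rightarrow> ('e \<Rightarrow> real) \<Rightarrow> real measure" where
  "posterior_law p prior \<alpha> n y f =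
     distr (frac_posterior (prior n) (\<alpha> n) (\<lambda>\<eta>. log_lik p n \<eta> y)) borel f"

definition rescaled_interval :: "real \<Rightarrow> real \<Rightarrow> real measure \<Rightarrow> real \<Rightarrow> real set" where
  "rescaled_interval \<delta> a Q m =
     {sqrt a * (quantile Q (\<delta> / 2) - m) + m <.. sqrt a * (quantile Q (1 - \<delta> / 2) - m) + m}"


section \<open>Local asymptotic normality and linear efficiency\<close>

text \<open>\<open>H\<close> is a subspace of an ambient vector space, with its own inner product \<open>L\<close>, because only the
  differences \<open>\<eta> - \<eta>0\<close>, and not the parameters, need to lie in the Hilbert space.\<close>

definition hilbert_space_on :: "'e::real_vector set \<Rightarrow> ('e \<Rightarrow> 'e \<Rightarrow> real) \<Rightarrow> bool" where
  "hilbert_space_on H L \<longleftrightarrow>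
     subspace H \<and>
     (\<forall>x\<in>H. \<forall>y\<in>H. L x y = L y x) \<and>
     (\<forall>x\<in>H. \<forall>y\<in>H. \<forall>z\<in>H. L (x + y) z = L x z + L y z) \<and>
     (\<forall>c. \<forall>x\<in>H. \<forall>y\<in>H. L (c *\<^sub>R x) y = c * L x y) \<and>
     (\<forall>x\<in>H. 0 \<le> L x x) \<and>
     (\<forall>x\<in>H. L x x = 0 \<longrightarrow> x = 0) \<and>
     Metric_space.mcomplete H (\<lambda>x y. sqrt (L (x - y) (x - y)))"

text \<open>\<open>L h h\<close> is the squared norm of \<open>h\<close>, and \<open>W n h\<close> is linear in \<open>h\<close> as a random variable.  The
  expansion is asserted almost surely under the true law because \<open>log_lik p n \<eta>0\<close> is finite only
  almost surely.  The remainder is extended-real since \<open>log_lik p n \<eta>\<close> may be \<open>-\<infinity>\<close>.\<close>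

definition LAN_expansion ::
    "'e::real_vector set \<Rightarrow> (nat \<Rightarrow> 'e \<Rightarrow> 'y measure) \<Rightarrow> (nat \<Rightarrow> 'e \<Rightarrow> 'y \<Rightarrow> real) \<Rightarrow> 'e \<Rightarrow>
     'e set \<Rightarrow> ('e \<Rightarrow> 'e \<Rightarrow> real) \<Rightarrow> (nat \<Rightarrow> 'e \<Rightarrow> 'y \<Rightarrow> real) \<Rightarrow> (nat \<Rightarrow> 'e \<Rightarrow> 'e \<Rightarrow> 'y \<Rightarrow> ereal) \<Rightarrow> bool" where
  "LAN_expansion S P p \<eta>0 H L W R \<longleftrightarrow>
     hilbert_space_on H L \<and>
     (\<forall>\<eta>\<in>S. \<eta> - \<eta>0 \<in> H) \<and>
     (\<forall>n. \<forall>h\<in>H. W n h \<in> borel_measurable (P n \<eta>0)) \<and>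
     (\<forall>n. \<forall>g\<in>H. \<forall>h\<in>H. \<forall>b c. AE y in P n \<eta>0. W n (b *\<^sub>R g + c *\<^sub>R h) y = b * W n g y + c * W n h y) \<and>
     (\<forall>h\<in>H. weak_conv_m (\<lambda>n. distr (P n \<eta>0) borel (W n h)) (centered_normal (L h h))) \<and>
     (\<forall>n. \<forall>\<eta>\<in>S. AE y in P n \<eta>0.
        log_lik p n \<eta> y =
          log_lik p n \<eta>0 y
          + ereal (- (real n / 2) * L (\<eta> - \<eta>0) (\<eta> - \<eta>0) + sqrt (real n) * W n (\<eta> - \<eta>0) y)
          + R n \<eta> \<eta>0 y)"

definition linear_efficient ::
    "(nat \<Rightarrow> 'e \<Rightarrow> 'y measure) \<Rightarrow> 'e \<Rightarrow> ('e \<Rightarrow> real) \<Rightarrow> (nat \<Rightarrow> 'e \<Rightarrow> 'y \<Rightarrow> real) \<Rightarrow> 'e \<Rightarrow>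
     (nat \<Rightarrow> 'y \<Rightarrow> real) \<Rightarrow> bool" where
  "linear_efficient P \<eta>0 \<psi> W \<psi>0 est \<longleftrightarrow>
     small_o_P_root_n (\<lambda>n. P n \<eta>0) (\<lambda>n y. est n y - (\<psi> \<eta>0 + W n \<psi>0 y / sqrt (real n)))"

end

(* Closeness to N(0,V) in bounded Lipschitz distance forces closeness of u-quantiles, because the
   normal distribution function is continuous and strictly increasing.  Quantiles commute with the
   increasing affine map x |-> sqrt(n a) (x - psihat), so the quantile a_u of the a-posterior satisfies
   sqrt(n a) (a_u - psihat) -> z_u in probability.  The rescaled endpoint E_u = sqrt a (a_u - psibar) + psibar
   then has sqrt n (E_u - psihat) = sqrt(n a) (a_u - psihat) + (1 - sqrt a) sqrt n (psibar - psihat) -> z_u,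
   and Slutsky's lemma gives P0(E_u < psi(eta0)) -> Phi(-z_u) = 1 - u.  The coverage event is the
   difference of two such events, which are nested.  For fixed a the median has z_{1/2} = 0, hence
   sqrt n (a_{1/2} - psihat) -> 0. *)

theory Submission
  imports Defs
begin

subsection \<open>Quantiles\<close>

text \<open>The superlevel set of the distribution function is an up-closed ray: bounded below
  because \<open>0 < u\<close> and the function vanishes at minus infinity, and closed by right
  continuity, so the infimum is attained. The witness \<open>x0\<close> makes it nonempty, since
  \<open>Q\<close> may have total mass below \<open>u\<close>.\<close>

lemma quantile_le_iff:
  assumes "finite_borel_measure Q" and u: "0 < u" and ex: "u \<le> cdf Q x0"
  shows "quantile Q u \<le> x \<longleftrightarrow> u \<le> cdf Q x"
proof -
  interpret finite_borel_measure Q by fact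
  let ?A = "{x. u \<le> cdf Q x}"
  have "eventually (\<lambda>x. cdf Q x < u) at_bot"
    using cdf_lim_at_bot u by (rule order_tendstoD)
  then obtain b where b: "\<And>x. x \<le> b \<Longrightarrow> cdf Q x < u"
    by (auto simp: eventually_at_bot_linorder)
  have bdd: "bdd_below ?A"
    by (rule bdd_belowI[of _ b]) (metis b linorder_not_le mem_Collect_eq nle_le)
  show ?thesis
  proof
    assume "u \<le> cdf Q x"
    then show "quantile Q u \<le> x"
      unfolding quantile_def by (intro cInf_lower bdd) auto
  next
    assume le: "quantile Q u \<le> x"
    \<comment> \<open>The infimum yields the bound only strictly to the right of \<open>x\<close>;
      right continuity then carries it to \<open>x\<close> itself.\<close>
    have above: "u \<le> cdf Q y" if "x < y" for y
    proof -
      have "Inf ?A < y" using le that by (simp add: quantile_def)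
      then obtain w where "u \<le> cdf Q w" "w < y"
        using ex by (subst (asm) cInf_less_iff) (auto intro: bdd)
      then show ?thesis using cdf_nondecreasing[of w y] by simp
    qed
    have "(cdf Q \<longlongrightarrow> cdf Q x) (at_right x)"
      using cdf_is_right_cont[of x] by (simp add: continuous_within)
    then show "u \<le> cdf Q x"
      by (rule tendsto_lowerbound)
         (auto simp: eventually_at_filter intro!: always_eventually above)
  qed
qed

lemma quantile_mono:
  assumes "finite_borel_measure Q" "0 < u" "u \<le> u'" "u' \<le> cdf Q x0"
  shows "quantile Q u \<le> quantile Q u'"
proof -
  have "u' \<le> cdf Q (quantile Q u')"
    using quantile_le_iff[of Q u' x0 "quantile Q u'"] assms by simp
  then show ?thesis
    using quantile_le_iff[of Q u x0 "quantile Q u'"] assms by simp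
qed

lemma cdf_distr_affine:
  assumes "sets Q = sets borel" "0 < s"
  shows "cdf (distr Q borel (\<lambda>x. s * (x - c))) x = cdf Q (x / s + c)"
proof -
  have "(\<lambda>x. s * (x - c)) \<in> measurable Q borel"
    by (simp add: measurable_cong_sets[OF assms(1) refl])
  then have "measure (distr Q borel (\<lambda>x. s * (x - c))) {..x}
      = measure Q ((\<lambda>x. s * (x - c)) -` {..x} \<inter> space Q)"
    by (rule measure_distr) simp
  also have "(\<lambda>x. s * (x - c)) -` {..x} \<inter> space Q = {..x / s + c}"
    using assms sets_eq_imp_space_eq[OF assms(1)] by (auto simp: field_simps)
  finally show ?thesis by (simp add: cdf_def)
qed

text \<open>Both sides are at most \<open>x\<close> exactly when
  \<open>u \<le> cdf Q (x / s + c)\<close>, and reals with the same upper bounds coincide.\<close>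

lemma quantile_distr_affine:
  assumes "finite_borel_measure Q" "0 < u" "u \<le> cdf Q x0" "0 < s"
  shows "quantile (distr Q borel (\<lambda>x. s * (x - c))) u = s * (quantile Q u - c)"
proof -
  interpret finite_borel_measure Q by fact
  let ?Q' = "distr Q borel (\<lambda>x. s * (x - c))"
  have F: "finite_borel_measure ?Q'"
    by (simp add: finite_borel_measure_def finite_borel_measure_axioms_def finite_measure_distr
        measurable_cong_sets[OF M_is_borel refl])
  have cdf: "cdf ?Q' x = cdf Q (x / s + c)" for x
    using M_is_borel assms(4) by (intro cdf_distr_affine) auto
  have "quantile ?Q' u \<le> x \<longleftrightarrow> s * (quantile Q u - c) \<le> x" for x
  proof -
    have "quantile ?Q' u \<le> x \<longleftrightarrow> u \<le> cdf Q (x / s + c)"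
      using quantile_le_iff[OF F assms(2), of "s * (x0 - c)" x] assms(3,4) by (simp add: cdf)
    also have "\<dots> \<longleftrightarrow> quantile Q u \<le> x / s + c"
      using quantile_le_iff[OF assms(1,2,3)] by simp
    also have "\<dots> \<longleftrightarrow> s * (quantile Q u - c) \<le> x"
      using assms(4) by (simp add: field_simps)
    finally show ?thesis .
  qed
  then show ?thesis by (metis order_antisym order_refl)
qed


subsection \<open>The bounded Lipschitz distance\<close>

lemma bounded_lipschitz_dist_commute:
  "bounded_lipschitz_dist Q Q' = bounded_lipschitz_dist Q' Q"
  by (simp add: bounded_lipschitz_dist_def abs_minus_commute)

text \<open>A supremum of reals dominates its members only once the family is known to be bounded;
  the sum of the two total masses is a bound.\<close>

lemma integral_diff_le_bounded_lipschitz_dist: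
  assumes "finite_borel_measure Q" "finite_borel_measure Q'"
    and f: "1-lipschitz_on UNIV f" "\<And>x. \<bar>f x\<bar> \<le> 1"
  shows "\<bar>(LINT x|Q. f x) - (LINT x|Q'. f x)\<bar> \<le> bounded_lipschitz_dist Q Q'"
proof -
  have le: "\<bar>LINT x|M. g x\<bar> \<le> measure M (space M)"
    if "finite_borel_measure M" "1-lipschitz_on UNIV g" "\<And>x. \<bar>g x\<bar> \<le> 1"
    for M and g :: "real \<Rightarrow> real"
  proof -
    interpret finite_borel_measure M by fact
    have "g \<in> borel_measurable M"
      using borel_measurable_continuous_onI[OF lipschitz_on_continuous_on[OF that(2)]]
      by (simp add: measurable_cong_sets[OF M_is_borel refl])
    then have "integrable M g"
      using that(3) by (intro integrable_const_bound[where B=1]) auto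
    then have "(LINT x|M. \<bar>g x\<bar>) \<le> (LINT x|M. 1)"
      using that(3) by (intro integral_mono) auto
    also have "\<dots> = measure M (space M)" by simp
    finally show ?thesis by (rule order_trans[OF integral_abs_bound])
  qed
  have "bdd_above ((\<lambda>f :: real \<Rightarrow> real. \<bar>(LINT x|Q. f x) - (LINT x|Q'. f x)\<bar>) `
      {f. 1-lipschitz_on UNIV f \<and> (\<forall>x. \<bar>f x\<bar> \<le> 1)})"
  proof (rule bdd_aboveI2)
    fix g :: "real \<Rightarrow> real" assume g: "g \<in> {f. 1-lipschitz_on UNIV f \<and> (\<forall>x. \<bar>f x\<bar> \<le> 1)}"
    show "\<bar>(LINT x|Q. g x) - (LINT x|Q'. g x)\<bar> \<le> measure Q (space Q) + measure Q' (space Q')"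
      using le[OF assms(1), of g] le[OF assms(2), of g] g by auto
  qed
  then show ?thesis
    unfolding bounded_lipschitz_dist_def using f by (intro cSUP_upper) auto
qed

text \<open>A Levy-type comparison by a ramp test function. Slope at most 1 over a stretch of length
  \<open>d\<close> allows only a drop of height \<open>d\<close>, hence the factor \<open>d\<close>;
  \<open>d \<le> 1\<close> keeps the ramp within the unit bound.\<close>

lemma cdf_le_bounded_lipschitz_dist:
  assumes "finite_borel_measure Q" "finite_borel_measure Q'" and d: "0 < d" "d \<le> 1"
  shows "d * cdf Q x \<le> d * cdf Q' (x + d) + bounded_lipschitz_dist Q Q'"
proof -
  \<comment> \<open>1-Lipschitz, and between \<open>d\<close> times the indicators of \<open>{..x}\<close> and \<open>{..x + d}\<close>\<close>
  define f where "f t = max 0 (min d (x + d - t))" for t :: real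
  have lip: "1-lipschitz_on UNIV f"
    by (rule lipschitz_onI) (auto simp: f_def dist_real_def)
  have bd: "\<bar>f t\<bar> \<le> 1" for t
    using d by (auto simp: f_def)
  have int: "integrable M f" if "finite_borel_measure M" for M
  proof -
    interpret finite_borel_measure M by fact
    have "f \<in> borel_measurable M"
      using borel_measurable_continuous_onI[OF lipschitz_on_continuous_on[OF lip]]
      by (simp add: measurable_cong_sets[OF M_is_borel refl])
    then show ?thesis
      using bd by (intro integrable_const_bound[where B=1]) auto
  qed
  have cdf: "(LINT t|M. d * indicator {..a} t) = d * cdf M a"
    "integrable M (\<lambda>t. d * indicator {..a} t)" if "finite_borel_measure M" for M a
  proof -
    interpret finite_borel_measure M by fact
    show "(LINT t|M. d * indicator {..a} t) = d * cdf M a"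
      by (simp add: cdf_def sets_eq_imp_space_eq[OF M_is_borel])
    show "integrable M (\<lambda>t. d * indicator {..a} t)"
      by (intro integrable_mult_right) (simp add: integrable_indicator_iff emeasure_finite less_top[symmetric]
          M_is_borel sets_eq_imp_space_eq[OF M_is_borel])
  qed
  have "d * cdf Q x \<le> (LINT t|Q. f t)"
    unfolding cdf(1)[OF assms(1), symmetric]
    using d by (intro integral_mono cdf int assms) (auto simp: f_def indicator_def)
  moreover have "(LINT t|Q'. f t) \<le> d * cdf Q' (x + d)"
    unfolding cdf(1)[OF assms(2), symmetric]
    using d by (intro integral_mono cdf int assms) (auto simp: f_def indicator_def)
  ultimately show ?thesis
    using integral_diff_le_bounded_lipschitz_dist[OF assms(1,2) lip bd] by linarith
qed

text \<open>Strict increase of \<open>cdf N\<close> through level \<open>u\<close> at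
  \<open>z\<close> leaves a gap on either side, and a small distance cannot bridge it. Existence of
  \<open>x\<close> is part of the conclusion because it shows that the quantile of \<open>Q\<close>
  is not a default value.\<close>

lemma bounded_lipschitz_close_imp_quantile_close:
  assumes N: "finite_borel_measure N" and u: "0 < u"
    and z: "cdf N z = u" "\<And>x. x < z \<Longrightarrow> cdf N x < u" "\<And>x. z < x \<Longrightarrow> u < cdf N x"
    and e: "0 < e" "e \<le> 1"
  obtains \<kappa> where "0 < \<kappa>"
    "\<And>Q. finite_borel_measure Q \<Longrightarrow> bounded_lipschitz_dist Q N \<le> \<kappa> \<Longrightarrow>
       (\<exists>x. u \<le> cdf Q x) \<and> \<bar>quantile Q u - z\<bar> \<le> e"
proof -
  \<comment> \<open>Half of \<open>e\<close> is spent on stepping away from \<open>z\<close> to open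
    a gap, the other half on the shift in the comparison of distribution functions.\<close>
  define d where "d = e / 2"
  \<comment> \<open>The smaller gap times \<open>d\<close>, halved so that the lower inequality is
    strict: \<open>cdf Q (z - e) < u\<close> is what puts the quantile to the right of
    \<open>z - e\<close>.\<close>
  define \<kappa> where "\<kappa> = d / 2 * min (u - cdf N (z - d)) (cdf N (z + d) - u)"
  have d: "0 < d" "d \<le> 1" using e by (auto simp: d_def)
  have m: "0 < min (u - cdf N (z - d)) (cdf N (z + d) - u)"
    using z(2)[of "z - d"] z(3)[of "z + d"] d by simp
  have pos: "0 < \<kappa>"
    unfolding \<kappa>_def using m d by (intro mult_pos_pos) auto
  have k: "\<kappa> < d * (u - cdf N (z - d))" "\<kappa> \<le> d * (cdf N (z + d) - u)"
  proof -
    have 2: "\<kappa> < d * min (u - cdf N (z - d)) (cdf N (z + d) - u)"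
      using m d unfolding \<kappa>_def by (intro mult_strict_right_mono) auto
    also have "\<dots> \<le> d * (u - cdf N (z - d))"
      using d by (intro mult_left_mono) auto
    finally show "\<kappa> < d * (u - cdf N (z - d))" .
    have "d * min (u - cdf N (z - d)) (cdf N (z + d) - u) \<le> d * (cdf N (z + d) - u)"
      using d by (intro mult_left_mono) auto
    with 2 show "\<kappa> \<le> d * (cdf N (z + d) - u)" by linarith
  qed
  show ?thesis
  proof (rule that[OF pos])
    fix Q assume Q: "finite_borel_measure Q" and bl: "bounded_lipschitz_dist Q N \<le> \<kappa>"
    have "d * cdf Q (z - e) \<le> d * cdf N (z - e + d) + \<kappa>"
      using cdf_le_bounded_lipschitz_dist[OF Q N d, of "z - e"] bl by linarith
    also have "\<dots> < d * u"
      using k(1) by (simp add: d_def algebra_simps)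
    finally have lo: "cdf Q (z - e) < u" using d by simp
    have "d * u \<le> d * cdf N (z + d) - \<kappa>"
      using k(2) by (simp add: algebra_simps)
    also have "\<dots> \<le> d * cdf Q (z + d + d)"
      using cdf_le_bounded_lipschitz_dist[OF N Q d, of "z + d"] bl
      by (simp add: bounded_lipschitz_dist_commute)
    finally have hi: "u \<le> cdf Q (z + e)" using d by (simp add: d_def add.commute)
    show "(\<exists>x. u \<le> cdf Q x) \<and> \<bar>quantile Q u - z\<bar> \<le> e"
      using quantile_le_iff[OF Q u hi, of "z - e"] quantile_le_iff[OF Q u hi, of "z + e"] lo hi
      by auto
  qed
qed


subsection \<open>Normal laws and convergence in probability\<close>

lemma real_distribution_centered_normal:
  assumes "0 < V"
  shows "real_distribution (centered_normal V)"
proof -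
  interpret prob_space "density lborel (normal_density 0 (sqrt V))"
    using assms by (intro prob_space_normal_density) simp
  show ?thesis
    using assms by (auto simp: centered_normal_def real_distribution_def real_distribution_axioms_def
        prob_space_axioms)
qed

text \<open>A positive density gives the same null sets as Lebesgue measure: points are null
  (continuity) and nonempty intervals are not (strict increase). Evenness of the density gives the
  reflection formula.\<close>

lemma cdf_centered_normal:
  assumes "0 < V"
  shows isCont_cdf_centered_normal: "isCont (cdf (centered_normal V)) x"
    and strict_mono_cdf_centered_normal: "strict_mono (cdf (centered_normal V))"
    and cdf_centered_normal_uminus: "cdf (centered_normal V) (- x) = 1 - cdf (centered_normal V) x"
proof -
  let ?N = "centered_normal V"
  interpret real_distribution ?N by (rule real_distribution_centered_normal[OF assms])
  have N: "?N = density lborel (normal_density 0 (sqrt V))"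
    using assms by (simp add: centered_normal_def)
  have nn: "0 < normal_density 0 (sqrt V) t" for t
    using assms by (intro normal_density_pos) simp
  have null: "A \<in> null_sets ?N \<longleftrightarrow> A \<in> null_sets lborel" for A
    unfolding N using nn by (auto simp: null_sets_density_iff less_imp_neq[symmetric] AE_iff_null_sets[symmetric] AE_not_in)
  have pt: "measure ?N {t} = 0" for t
    using null[of "{t}"] by (auto simp: measure_def null_sets_def)
  show "isCont (cdf ?N) x" by (simp add: isCont_cdf pt)
  show "strict_mono (cdf ?N)"
  proof (rule strict_monoI)
    fix a b :: real assume "a < b"
    then have "{a<..b} \<notin> null_sets ?N" unfolding null by (simp add: null_sets_def)
    then have "measure ?N {a<..b} \<noteq> 0" by (simp add: emeasure_eq_measure null_sets_def)
    then have "0 < measure ?N {a<..b}" by (simp add: zero_less_measure_iff)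
    then show "cdf ?N a < cdf ?N b" using cdf_diff_eq[OF \<open>a < b\<close>] by simp
  qed
  have "emeasure ?N {..-x} = (\<integral>\<^sup>+t. ennreal (normal_density 0 (sqrt V) t) * indicator {..-x} t \<partial>lborel)"
    unfolding N by (subst emeasure_density) auto
  \<comment> \<open>Substitution \<open>t\<close> to \<open>- t\<close>; the density is unchanged
    and the half-line is reflected.\<close>
  also have "\<dots> = (\<integral>\<^sup>+t. ennreal (normal_density 0 (sqrt V) (- t)) * indicator {..-x} (-t) \<partial>lborel)"
    using nn_integral_real_affine[of "\<lambda>t. ennreal (normal_density 0 (sqrt V) t) * indicator {..-x} t" "-1" 0]
    by simp
  also have "\<dots> = (\<integral>\<^sup>+t. ennreal (normal_density 0 (sqrt V) t) * indicator {x..} t \<partial>lborel)"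
    by (intro nn_integral_cong) (auto simp: normal_density_def indicator_def)
  also have "\<dots> = emeasure ?N {x..}"
    unfolding N by (subst emeasure_density) auto
  finally have "cdf ?N (-x) = measure ?N {x..}" by (simp add: cdf_def measure_def)
  \<comment> \<open>The complement of \<open>{..x}\<close> is the open half-line, so the massless
    endpoint is split off.\<close>
  also have "\<dots> = measure ?N ({x<..} \<union> {x})"
    by (rule arg_cong[of _ _ "measure ?N"]) auto
  also have "\<dots> = measure ?N {x<..}"
    by (subst finite_measure_Union) (auto simp: pt)
  also have "\<dots> = measure ?N (space ?N - {..x})"
    by (rule arg_cong[of _ _ "measure ?N"]) auto
  also have "\<dots> = 1 - cdf ?N x"
    by (subst prob_compl) (auto simp: cdf_def)
  finally show "cdf ?N (- x) = 1 - cdf ?N x" .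
qed

lemma centered_normal_quantile:
  assumes "0 < V" "0 < u" "u < 1"
  obtains z where "cdf (centered_normal V) z = u"
    "\<And>x. x < z \<Longrightarrow> cdf (centered_normal V) x < u" "\<And>x. z < x \<Longrightarrow> u < cdf (centered_normal V) x"
proof -
  let ?F = "cdf (centered_normal V)"
  interpret real_distribution "centered_normal V" by (rule real_distribution_centered_normal[OF assms(1)])
  have "eventually (\<lambda>x. ?F x < u) at_bot"
    using cdf_lim_at_bot assms(2) by (rule order_tendstoD)
  then obtain a where a: "?F a < u" by (auto simp: eventually_at_bot_linorder)
  have "eventually (\<lambda>x. u < ?F x) at_top"
    using cdf_lim_at_top_prob assms(3) by (rule order_tendstoD)
  then obtain b where b: "u < ?F b" by (auto simp: eventually_at_top_linorder)
  have "a \<le> b"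
    using a b cdf_nondecreasing[of b a] by (cases "a \<le> b") auto
  then obtain z where "?F z = u"
    using IVT[of ?F a u b] a b isCont_cdf_centered_normal[OF assms(1)] by force
  then show ?thesis
    using that strict_monoD[OF strict_mono_cdf_centered_normal[OF assms(1)]] by blast
qed

section \<open>Outer measure bounds and Slutsky's lemma\<close>

lemma outer_measure_of_Un_le:
  assumes "A \<subseteq> space M" "B \<subseteq> space M"
  shows "outer_measure_of M (A \<union> B) \<le> outer_measure_of M A + outer_measure_of M B"
proof -
  obtain E F where E: "E \<in> sets M" "A \<subseteq> E" "outer_measure_of M A = emeasure M E"
    and F: "F \<in> sets M" "B \<subseteq> F" "outer_measure_of M B = emeasure M F"
    using outer_measure_of_attain assms by metis
  have "outer_measure_of M (A \<union> B) \<le> outer_measure_of M (E \<union> F)"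
    using E F by (intro outer_measure_of_mono) auto
  also have "\<dots> \<le> emeasure M E + emeasure M F"
    using E F by (simp add: emeasure_subadditive)
  finally show ?thesis using E F by simp
qed

text \<open>The union bound for outer measure, so \<open>Z\<close> may describe non-measurable
  events. The inclusion is required only eventually, because the scale \<open>sqrt (real n)\<close>
  vanishes at \<open>n = 0\<close>.\<close>

lemma tendsto_zero_in_prob_subset:
  assumes X: "tendsto_zero_in_prob M X" "0 < a" and Y: "tendsto_zero_in_prob M Y" "0 < b"
    and sub: "eventually (\<lambda>n. \<forall>y\<in>space (M n). Z n y \<longrightarrow> a < \<bar>X n y\<bar> \<or> b < \<bar>Y n y\<bar>) sequentially"
  shows "(\<lambda>n. outer_measure_of (M n) {y \<in> space (M n). Z n y}) \<longlonglongrightarrow> 0"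
proof -
  let ?A = "\<lambda>n. {y \<in> space (M n). a < \<bar>X n y\<bar>}" and ?B = "\<lambda>n. {y \<in> space (M n). b < \<bar>Y n y\<bar>}"
  have le: "eventually (\<lambda>n. outer_measure_of (M n) {y \<in> space (M n). Z n y}
      \<le> outer_measure_of (M n) (?A n) + outer_measure_of (M n) (?B n)) sequentially"
    using sub
  proof eventually_elim
    case (elim n)
    have "outer_measure_of (M n) {y \<in> space (M n). Z n y} \<le> outer_measure_of (M n) (?A n \<union> ?B n)"
      using elim by (intro outer_measure_of_mono) auto
    also have "\<dots> \<le> outer_measure_of (M n) (?A n) + outer_measure_of (M n) (?B n)"
      by (rule outer_measure_of_Un_le) auto
    finally show ?case .
  qed
  have "(\<lambda>n. outer_measure_of (M n) (?A n) + outer_measure_of (M n) (?B n)) \<longlonglongrightarrow> 0 + 0"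
    using X Y by (intro tendsto_add) (auto simp: tendsto_zero_in_prob_def)
  then have "(\<lambda>n. outer_measure_of (M n) (?A n) + outer_measure_of (M n) (?B n)) \<longlonglongrightarrow> 0" by simp
  then show ?thesis
    using tendsto_sandwich[OF _ le tendsto_const] by simp
qed

text \<open>Off the event that \<open>D\<close> exceeds \<open>e\<close> in absolute value, the
  event in question lies between two sublevel sets of \<open>X\<close> with thresholds near
  \<open>x\<close>. Let \<open>n\<close> grow first, then let \<open>e\<close> shrink, using
  continuity of \<open>cdf N\<close>.\<close>

lemma slutsky_cdf:
  assumes M: "\<And>n. prob_space (M n)"
    and X: "\<And>n. X n \<in> borel_measurable (M n)" and D: "\<And>n. D n \<in> borel_measurable (M n)"
    and conv: "weak_conv_m (\<lambda>n. distr (M n) borel (X n)) N" and cont: "\<And>x. isCont (cdf N) x"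
    and D0: "tendsto_zero_in_prob M D"
  shows "(\<lambda>n. measure (M n) {y \<in> space (M n). X n y + D n y < x}) \<longlonglongrightarrow> cdf N x"
proof -
  let ?g = "\<lambda>n. measure (M n) {y \<in> space (M n). X n y + D n y < x}"
  let ?b = "\<lambda>e n. measure (M n) {y \<in> space (M n). e < \<bar>D n y\<bar>}"
  let ?F = "\<lambda>n t. measure (M n) {y \<in> space (M n). X n y \<le> t}"
  note [measurable] = X D
  have F: "(\<lambda>n. ?F n t) \<longlonglongrightarrow> cdf N t" for t
  proof -
    have "cdf (distr (M n) borel (X n)) t = ?F n t" for n
      unfolding cdf_def by (subst measure_distr) (auto intro!: arg_cong[of _ _ "measure (M n)"])
    moreover have "(\<lambda>n. cdf (distr (M n) borel (X n)) t) \<longlonglongrightarrow> cdf N t"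
      using conv cont by (simp add: weak_conv_m_def weak_conv_def)
    ultimately show ?thesis by simp
  qed
  have b: "?b e \<longlonglongrightarrow> 0" if "0 < e" for e
  proof -
    have "(\<lambda>n. emeasure (M n) {y \<in> space (M n). e < \<bar>D n y\<bar>}) \<longlonglongrightarrow> 0"
      using D0 that by (auto simp: tendsto_zero_in_prob_def outer_measure_of_eq)
    then have "(\<lambda>n. enn2real (emeasure (M n) {y \<in> space (M n). e < \<bar>D n y\<bar>})) \<longlonglongrightarrow> enn2real 0"
      by (intro tendsto_enn2real) auto
    then show ?thesis by (simp add: measure_def)
  qed
  have up: "?g n \<le> ?F n (x + e) + ?b e n" for n e
  proof -
    interpret prob_space "M n" by fact
    have "?g n \<le> measure (M n) ({y \<in> space (M n). X n y \<le> x + e} \<union> {y \<in> space (M n). e < \<bar>D n y\<bar>})"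
      by (intro finite_measure_mono) auto
    also have "\<dots> \<le> ?F n (x + e) + ?b e n" by (intro measure_Un_le) auto
    finally show ?thesis .
  qed
  \<comment> \<open>One \<open>e\<close> absorbs \<open>D\<close>; the second makes the sum strictly
    smaller than \<open>x\<close>.\<close>
  have low: "?F n (x - 2 * e) - ?b e n \<le> ?g n" if "0 < e" for n e
  proof -
    interpret prob_space "M n" by fact
    have "?F n (x - 2 * e) \<le> measure (M n) ({y \<in> space (M n). X n y + D n y < x} \<union> {y \<in> space (M n). e < \<bar>D n y\<bar>})"
      using that by (intro finite_measure_mono) auto
    also have "\<dots> \<le> ?g n + ?b e n" by (intro measure_Un_le) auto
    finally show ?thesis by simp
  qed
  \<comment> \<open>Selects \<open>e\<close> so small that moving the argument by
    \<open>c * e\<close> keeps \<open>cdf N\<close> on the same side of the target value; used with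
    \<open>c = -2\<close> and \<open>c = 1\<close>.\<close>
  have near: "eventually (\<lambda>e. P (cdf N (x + c * e))) (at_right 0)"
    if "open {t. P t}" "P (cdf N x)" for P c
  proof -
    have "((\<lambda>e. cdf N (x + c * e)) \<longlongrightarrow> cdf N x) (at_right 0)"
      by (rule isCont_tendsto_compose[OF cont]) (auto intro!: tendsto_eq_intros)
    from topological_tendstoD[OF this that(1)] that(2) show ?thesis by simp
  qed
  show ?thesis
  proof (rule order_tendstoI)
    fix a assume "a < cdf N x"
    then have "eventually (\<lambda>e. a < cdf N (x + (-2) * e)) (at_right 0)"
      by (intro near) (auto simp: greaterThan_def[symmetric])
    then have "eventually (\<lambda>e. a < cdf N (x + (-2) * e) \<and> 0 < e) (at_right 0)"
      by (intro eventually_conj eventually_at_right_less)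
    then obtain e where e: "a < cdf N (x - 2 * e)" "0 < e"
      using eventually_happens'[OF trivial_limit_at_right_real] by force
    have "(\<lambda>n. ?F n (x - 2 * e) - ?b e n) \<longlonglongrightarrow> cdf N (x - 2 * e) - 0"
      using e by (intro tendsto_diff F b)
    then have "eventually (\<lambda>n. a < ?F n (x - 2 * e) - ?b e n) sequentially"
      using e by (intro order_tendstoD) auto
    then show "eventually (\<lambda>n. a < ?g n) sequentially"
      by eventually_elim (use low[OF e(2)] in \<open>auto intro: less_le_trans\<close>)
  next
    fix a assume "cdf N x < a"
    then have "eventually (\<lambda>e. cdf N (x + 1 * e) < a) (at_right 0)"
      by (intro near) (auto simp: lessThan_def[symmetric])
    then have "eventually (\<lambda>e. cdf N (x + 1 * e) < a \<and> 0 < e) (at_right 0)"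
      by (intro eventually_conj eventually_at_right_less)
    then obtain e where e: "cdf N (x + e) < a" "0 < e"
      using eventually_happens'[OF trivial_limit_at_right_real] by force
    have "(\<lambda>n. ?F n (x + e) + ?b e n) \<longlonglongrightarrow> cdf N (x + e) + 0"
      using e by (intro tendsto_add F b)
    then have "eventually (\<lambda>n. ?F n (x + e) + ?b e n < a) sequentially"
      using e by (intro order_tendstoD) auto
    then show "eventually (\<lambda>n. ?g n < a) sequentially"
      by eventually_elim (use up[of _ e] in \<open>auto intro: le_less_trans\<close>)
  qed
qed

subsection \<open>Fractional posteriors\<close>

lemma exp_mult_log_lik:
  "exp_mult a (log_lik p n \<eta> y) = (if 0 < p n \<eta> y then ennreal (exp (a * ln (p n \<eta> y))) else 0)"
  by (simp add: exp_mult_def log_lik_def)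

lemma exp_mult_log_lik_measurable:
  assumes "(\<lambda>(y, \<eta>). p n \<eta> y) \<in> borel_measurable (M \<Otimes>\<^sub>M K)"
  shows "(\<lambda>(y, \<eta>). exp_mult a (log_lik p n \<eta> y)) \<in> borel_measurable (M \<Otimes>\<^sub>M K)"
    and "y \<in> space M \<Longrightarrow> (\<lambda>\<eta>. exp_mult a (log_lik p n \<eta> y)) \<in> borel_measurable K"
proof -
  have [measurable]: "(\<lambda>x. p n (snd x) (fst x)) \<in> borel_measurable (M \<Otimes>\<^sub>M K)"
    using assms by (simp add: case_prod_beta)
  show *: "(\<lambda>(y, \<eta>). exp_mult a (log_lik p n \<eta> y)) \<in> borel_measurable (M \<Otimes>\<^sub>M K)"
    unfolding exp_mult_log_lik case_prod_beta by measurable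
  show "(\<lambda>\<eta>. exp_mult a (log_lik p n \<eta> y)) \<in> borel_measurable K" if "y \<in> space M"
    using measurable_compose[OF measurable_Pair1'[OF that] *] by simp
qed

lemma finite_borel_measure_of_le_1:
  assumes "sets Q = sets borel" "emeasure Q (space Q) \<le> 1"
  shows "finite_borel_measure Q"
  using assms by (auto simp: finite_borel_measure_def finite_borel_measure_axioms_def
      intro!: finite_measureI dest: order_le_less_trans[OF _ ennreal_one_less_top])

text \<open>The sample size is fixed, and \<open>M\<close> stands for the law of the data under the
  true parameter. The assumptions do not mention \<open>\<alpha>\<close>, so the locale predicate
  does not take it and one instance serves every exponent sequence.\<close>

locale posterior_of_functional =
  fixes p :: "nat \<Rightarrow> 'e \<Rightarrow> 'y \<Rightarrow> real" and prior :: "nat \<Rightarrow> 'e measure" and n :: nat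
    and M :: "'y measure" and \<psi> :: "'e \<Rightarrow> real" and \<alpha> :: "nat \<Rightarrow> real"
  assumes prior: "sigma_finite_measure (prior n)"
    and joint: "(\<lambda>(y, \<eta>). p n \<eta> y) \<in> borel_measurable (M \<Otimes>\<^sub>M prior n)"
    and functional [measurable]: "\<psi> \<in> borel_measurable (prior n)"
begin

abbreviation Q :: "'y \<Rightarrow> real measure" where "Q y \<equiv> posterior_law p prior \<alpha> n y \<psi>"

abbreviation lik :: "'y \<Rightarrow> 'e \<Rightarrow> ennreal" where "lik y \<eta> \<equiv> exp_mult (\<alpha> n) (log_lik p n \<eta> y)"

lemma sets_Q [simp]: "sets (Q y) = sets borel"
  by (simp add: posterior_law_def)

lemma space_Q [simp]: "space (Q y) = UNIV"
  by (simp add: posterior_law_def)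

text \<open>Bayes' formula for the push-forward. As a quotient of integrals over the prior it makes
  both the total mass and the dependence on \<open>y\<close> accessible.\<close>

lemma emeasure_Q:
  assumes "y \<in> space M" "A \<in> sets borel"
  shows "emeasure (Q y) A =
    (1 / (\<integral>\<^sup>+\<eta>. lik y \<eta> \<partial>prior n)) * (\<integral>\<^sup>+\<eta>. lik y \<eta> * indicator A (\<psi> \<eta>) \<partial>prior n)"
proof -
  have [measurable]: "lik y \<in> borel_measurable (prior n)"
    using exp_mult_log_lik_measurable(2)[of p n M "prior n", OF joint assms(1)] .
  have [measurable]: "A \<in> sets borel" by fact
  have "\<psi> \<in> borel_measurable (frac_posterior (prior n) (\<alpha> n) (\<lambda>\<eta>. log_lik p n \<eta> y))"
    using functional by (simp add: frac_posterior_def cong: measurable_cong_sets)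
  then have "emeasure (Q y) A = (1 / (\<integral>\<^sup>+\<eta>. lik y \<eta> \<partial>prior n)) *
      emeasure (density (prior n) (lik y)) (\<psi> -` A \<inter> space (prior n))"
    unfolding posterior_law_def using assms by (subst emeasure_distr) (auto simp: frac_posterior_def space_scale_measure)
  also have "emeasure (density (prior n) (lik y)) (\<psi> -` A \<inter> space (prior n))
      = (\<integral>\<^sup>+\<eta>. lik y \<eta> * indicator (\<psi> -` A \<inter> space (prior n)) \<eta> \<partial>prior n)"
    by (rule emeasure_density) measurable
  also have "\<dots> = (\<integral>\<^sup>+\<eta>. lik y \<eta> * indicator A (\<psi> \<eta>) \<partial>prior n)"
    by (intro nn_integral_cong) (auto simp: indicator_def)
  finally show ?thesis .
qed

text \<open>The mass is \<open>1 / ?D * ?D\<close> in \<open>ennreal\<close>: this is 1 for a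
  positive finite normaliser, and the conventions for zero times infinity give 0 when
  \<open>?D\<close> is 0 or infinite.\<close>

lemma prob_space_or_null:
  assumes "y \<in> space M"
  shows "emeasure (Q y) UNIV = 1 \<or> emeasure (Q y) UNIV = 0"
proof -
  let ?D = "\<integral>\<^sup>+\<eta>. lik y \<eta> \<partial>prior n"
  have "emeasure (Q y) UNIV = 1 / ?D * ?D"
    using emeasure_Q[OF assms, of UNIV] by simp
  then show ?thesis
    by (cases "?D = 0"; cases "?D = \<top>")
      (auto simp: ennreal_divide_times ennreal_divide_self top.not_eq_extremum)
qed

lemma finite_borel_measure_Q:
  assumes "y \<in> space M"
  shows "finite_borel_measure (Q y)"
  using prob_space_or_null[OF assms] by (intro finite_borel_measure_of_le_1) auto

lemma prob_cdf_Q: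
  assumes "y \<in> space M" "emeasure (Q y) UNIV = 1" "u < 1"
  obtains x where "u \<le> cdf (Q y) x"
proof -
  interpret real_distribution "Q y"
    using assms(2) by (simp add: real_distribution_def real_distribution_axioms_def prob_spaceI)
  have "eventually (\<lambda>x. u < cdf (Q y) x) at_top"
    using cdf_lim_at_top_prob assms(3) by (rule order_tendstoD)
  then show ?thesis using that by (auto simp: eventually_at_top_linorder intro: less_imp_le)
qed

lemma null_cdf_Q:
  assumes "emeasure (Q y) UNIV = 0"
  shows "cdf (Q y) x = 0"
  using emeasure_mono[of "{..x}" UNIV "Q y"] assms by (simp add: cdf_def measure_def)

text \<open>For a null posterior law both quantiles are the same default \<open>Inf {}\<close>, so
  the order holds for every \<open>y\<close> and the endpoint events below are nested without an
  exceptional set.\<close>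

lemma quantile_mono_Q:
  assumes "y \<in> space M" "0 < u" "u \<le> u'" "u' < 1"
  shows "quantile (Q y) u \<le> quantile (Q y) u'"
proof (cases "emeasure (Q y) UNIV = 0")
  case True
  then show ?thesis using assms by (simp add: quantile_def null_cdf_Q)
next
  case False
  then obtain x where "u' \<le> cdf (Q y) x"
    using prob_space_or_null[OF assms(1)] prob_cdf_Q[OF assms(1) _ assms(4)] by blast
  then show ?thesis
    using finite_borel_measure_Q[OF assms(1)] assms by (intro quantile_mono)
qed

text \<open>Tonelli's theorem for the sigma-finite prior makes numerator and denominator of
  \<open>emeasure_Q\<close> measurable in \<open>y\<close>.\<close>

lemma cdf_Q_measurable [measurable]: "(\<lambda>y. cdf (Q y) t) \<in> borel_measurable M"
  and mass_Q_measurable [measurable]: "(\<lambda>y. emeasure (Q y) UNIV) \<in> borel_measurable M"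
proof -
  interpret sigma_finite_measure "prior n" by (rule prior)
  have [measurable]: "(\<lambda>x. lik (fst x) (snd x)) \<in> borel_measurable (M \<Otimes>\<^sub>M prior n)"
    using exp_mult_log_lik_measurable(1)[of p n M "prior n", OF joint] by (simp add: case_prod_beta)
  have *: "(\<lambda>y. emeasure (Q y) A) \<in> borel_measurable M" if [measurable]: "A \<in> sets borel" for A
  proof -
    have [measurable]: "(\<lambda>y. \<integral>\<^sup>+\<eta>. lik y \<eta> \<partial>prior n) \<in> borel_measurable M"
      "(\<lambda>y. \<integral>\<^sup>+\<eta>. lik y \<eta> * indicator A (\<psi> \<eta>) \<partial>prior n) \<in> borel_measurable M"
      by (auto intro!: borel_measurable_nn_integral simp: case_prod_beta)
    have "(\<lambda>y. (1 / (\<integral>\<^sup>+\<eta>. lik y \<eta> \<partial>prior n)) * (\<integral>\<^sup>+\<eta>. lik y \<eta> * indicator A (\<psi> \<eta>) \<partial>prior n))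
        \<in> borel_measurable M" by measurable
    then show ?thesis by (subst measurable_cong) (auto simp: emeasure_Q)
  qed
  show "(\<lambda>y. emeasure (Q y) UNIV) \<in> borel_measurable M" by (intro *) simp
  have [measurable]: "(\<lambda>y. emeasure (Q y) {..t}) \<in> borel_measurable M" by (intro *) simp
  show "(\<lambda>y. cdf (Q y) t) \<in> borel_measurable M" unfolding cdf_def measure_def by measurable
qed

text \<open>By \<open>quantile_le_iff\<close> a sublevel set of the quantile is an event about the
  distribution function at one fixed point.\<close>

lemma quantile_Q_measurable:
  assumes "0 < u" "u < 1"
  shows "(\<lambda>y. quantile (Q y) u) \<in> borel_measurable M"
proof (rule borel_measurable_iff_le[THEN iffD2], rule allI)
  fix t
  \<comment> \<open>for a null posterior law the quantile is the junk value \<open>Inf {}\<close>, which is at least the same for all \<open>y\<close>\<close>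
  have "quantile (Q y) u \<le> t \<longleftrightarrow>
      (if emeasure (Q y) UNIV = 0 then Inf {} \<le> t else u \<le> cdf (Q y) t)" if y: "y \<in> space M" for y
  proof (cases "emeasure (Q y) UNIV = 0")
    case True
    then show ?thesis using assms by (simp add: quantile_def null_cdf_Q not_le[symmetric])
  next
    case False
    then obtain x where "u \<le> cdf (Q y) x"
      using prob_space_or_null[OF y] prob_cdf_Q[OF y _ assms(2)] by blast
    from quantile_le_iff[OF finite_borel_measure_Q[OF y] assms(1) this] False show ?thesis by simp
  qed
  then have "{y \<in> space M. quantile (Q y) u \<le> t} =
      {y \<in> space M. if emeasure (Q y) UNIV = 0 then Inf {} \<le> t else u \<le> cdf (Q y) t}"
    by auto
  also have "\<dots> \<in> sets M" by measurable
  finally show "{y \<in> space M. quantile (Q y) u \<le> t} \<in> sets M" .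
qed

lemma posterior_law_affine:
  "posterior_law p prior \<alpha> n y (\<lambda>\<eta>. s * (\<psi> \<eta> - c)) = distr (Q y) borel (\<lambda>x. s * (x - c))"
proof -
  have "\<psi> \<in> borel_measurable (frac_posterior (prior n) (\<alpha> n) (\<lambda>\<eta>. log_lik p n \<eta> y))"
    using functional by (simp add: frac_posterior_def cong: measurable_cong_sets)
  then show ?thesis
    unfolding posterior_law_def by (subst distr_distr) (auto simp: comp_def)
qed

lemma finite_borel_measure_affine:
  assumes "y \<in> space M"
  shows "finite_borel_measure (posterior_law p prior \<alpha> n y (\<lambda>\<eta>. s * (\<psi> \<eta> - c)))"
proof -
  interpret finite_borel_measure "Q y" by (rule finite_borel_measure_Q[OF assms])
  show ?thesis
    unfolding posterior_law_affine
    by (simp add: finite_borel_measure_def finite_borel_measure_axioms_def finite_measure_distr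
        measurable_cong_sets[OF M_is_borel refl])
qed

lemma quantile_posterior_law_affine:
  assumes "y \<in> space M" "0 < s" "0 < u"
    and "u \<le> cdf (posterior_law p prior \<alpha> n y (\<lambda>\<eta>. s * (\<psi> \<eta> - c))) x"
  shows "quantile (posterior_law p prior \<alpha> n y (\<lambda>\<eta>. s * (\<psi> \<eta> - c))) u = s * (quantile (Q y) u - c)"
  using assms(4) unfolding posterior_law_affine cdf_distr_affine[OF sets_Q assms(2)]
  by (intro quantile_distr_affine finite_borel_measure_Q assms)

end


subsection \<open>Rescaled credible intervals\<close>

text \<open>A deviation of the rescaled quantile beyond \<open>\<epsilon>\<close> forces the bounded
  Lipschitz distance above a fixed \<open>\<kappa>\<close>, whose outer probability
  vanishes.\<close>

lemma rescaled_quantile_tendsto_in_prob: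
  assumes post: "\<And>n. posterior_of_functional p prior n (M n) \<psi>"
    and V: "0 < V" and u: "0 < u" "u < 1" and z: "cdf (centered_normal V) z = u"
    and \<alpha>: "\<And>n. 0 < \<alpha> n"
    and conv: "weak_conv_in_prob M
      (\<lambda>n y. posterior_law p prior \<alpha> n y (\<lambda>\<eta>. sqrt (real n * \<alpha> n) * (\<psi> \<eta> - h n y))) (centered_normal V)"
  shows "tendsto_zero_in_prob M
    (\<lambda>n y. sqrt (real n * \<alpha> n) * (quantile (posterior_law p prior \<alpha> n y \<psi>) u - h n y) - z)"
  unfolding tendsto_zero_in_prob_def
proof (intro allI impI)
  let ?N = "centered_normal V"
  fix \<epsilon> :: real assume \<epsilon>: "0 < \<epsilon>"
  interpret N: real_distribution ?N by (rule real_distribution_centered_normal[OF V])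
  have N: "finite_borel_measure ?N" by unfold_locales
  have mono: "cdf ?N a < cdf ?N b" if "a < b" for a b
    using strict_monoD[OF strict_mono_cdf_centered_normal[OF V] that] .
  obtain \<kappa> where "0 < \<kappa>" and \<kappa>:
    "\<And>Q. finite_borel_measure Q \<Longrightarrow> bounded_lipschitz_dist Q ?N \<le> \<kappa> \<Longrightarrow>
       (\<exists>x. u \<le> cdf Q x) \<and> \<bar>quantile Q u - z\<bar> \<le> min \<epsilon> 1"
    by (rule bounded_lipschitz_close_imp_quantile_close[OF N u(1) z, of "min \<epsilon> 1"])
      (use \<epsilon> mono z in auto)
  let ?A = "\<lambda>n y. sqrt (real n * \<alpha> n) * (quantile (posterior_law p prior \<alpha> n y \<psi>) u - h n y) - z"
  let ?R = "\<lambda>n y. posterior_law p prior \<alpha> n y (\<lambda>\<eta>. sqrt (real n * \<alpha> n) * (\<psi> \<eta> - h n y))"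
  have "\<kappa> < \<bar>bounded_lipschitz_dist (?R n y) ?N\<bar>"
    if n: "0 < n" and y: "y \<in> space (M n)" and large: "\<epsilon> < \<bar>?A n y\<bar>" for n y
  proof (rule ccontr)
    interpret posterior_of_functional p prior n "M n" \<psi> \<alpha> by (rule post)
    assume "\<not> ?thesis"
    \<comment> \<open>The existence part excludes a null posterior, for which the affine rule for
      quantiles could fail.\<close>
    then have *: "\<exists>x. u \<le> cdf (?R n y) x" "\<bar>quantile (?R n y) u - z\<bar> \<le> min \<epsilon> 1"
      using \<kappa>[OF finite_borel_measure_affine[OF y]] by auto
    have "0 < sqrt (real n * \<alpha> n)" using n \<alpha> by simp
    then have "quantile (?R n y) u - z = ?A n y"
      using quantile_posterior_law_affine[OF y _ u(1)] *(1) by auto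
    with *(2) large show False by simp
  qed
  then show "(\<lambda>n. outer_measure_of (M n) {y \<in> space (M n). \<epsilon> < \<bar>?A n y\<bar>}) \<longlonglongrightarrow> 0"
    using conv \<open>0 < \<kappa>\<close> unfolding weak_conv_in_prob_def
    \<comment> \<open>There is only one exceptional event, so the same sequence fills both
      slots.\<close>
    by (intro tendsto_zero_in_prob_subset[where a=\<kappa> and b=\<kappa>
          and X="\<lambda>n y. bounded_lipschitz_dist (?R n y) ?N" and Y="\<lambda>n y. bounded_lipschitz_dist (?R n y) ?N"])
      (auto intro!: eventually_mono[OF eventually_gt_at_top[of 0]])
qed

lemma rescaled_endpoint_coverage:
  assumes prob: "\<And>n. prob_space (M n)"
    and post: "\<And>n. posterior_of_functional p prior n (M n) \<psi>"
    and V: "0 < V" and u: "0 < u" "u < 1"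
    and \<alpha>: "\<And>n. 0 < \<alpha> n" "\<And>n. \<alpha> n \<le> 1"
    and h [measurable]: "\<And>n. h n \<in> borel_measurable (M n)"
    and m [measurable]: "\<And>n. m n \<in> borel_measurable (M n)"
    and conv: "weak_conv_in_prob M
      (\<lambda>n y. posterior_law p prior \<alpha> n y (\<lambda>\<eta>. sqrt (real n * \<alpha> n) * (\<psi> \<eta> - h n y))) (centered_normal V)"
    and normal: "weak_conv_m (\<lambda>n. distr (M n) borel (\<lambda>y. sqrt (real n) * (h n y - t))) (centered_normal V)"
    and close: "small_o_P_root_n M (\<lambda>n y. m n y - h n y)"
  shows "(\<lambda>n. measure (M n) {y \<in> space (M n).
      sqrt (\<alpha> n) * (quantile (posterior_law p prior \<alpha> n y \<psi>) u - m n y) + m n y < t}) \<longlonglongrightarrow> 1 - u"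
proof -
  let ?N = "centered_normal V"
  let ?a = "\<lambda>n y. quantile (posterior_law p prior \<alpha> n y \<psi>) u"
  let ?E = "\<lambda>n y. sqrt (\<alpha> n) * (?a n y - m n y) + m n y"
  obtain z where z: "cdf ?N z = u"
    using centered_normal_quantile[OF V u] by metis
  have [measurable]: "?a n \<in> borel_measurable (M n)" for n
  proof -
    interpret posterior_of_functional p prior n "M n" \<psi> \<alpha> by (rule post)
    show ?thesis by (rule quantile_Q_measurable[OF u])
  qed
  define D where "D n y = sqrt (real n) * (?E n y - h n y) - z" for n y
  \<comment> \<open>The error splits into the quantile error and the centering error. The weight
    \<open>1 - sqrt (\<alpha> n)\<close> lies between 0 and 1 uniformly in \<open>n\<close>, so
    exponents tending to 0 are covered.\<close>
  have D: "D n y = (sqrt (real n * \<alpha> n) * (?a n y - h n y) - z)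
      + (1 - sqrt (\<alpha> n)) * (sqrt (real n) * (m n y - h n y))" for n y
    by (simp add: D_def real_sqrt_mult algebra_simps)
  have Dle: "\<bar>D n y\<bar> \<le> \<bar>sqrt (real n * \<alpha> n) * (?a n y - h n y) - z\<bar> + \<bar>sqrt (real n) * (m n y - h n y)\<bar>" for n y
  proof -
    have "\<bar>(1 - sqrt (\<alpha> n)) * (sqrt (real n) * (m n y - h n y))\<bar> \<le> 1 * \<bar>sqrt (real n) * (m n y - h n y)\<bar>"
      unfolding abs_mult[of "1 - sqrt (\<alpha> n)"]
      using \<alpha>[of n] by (intro mult_right_mono) (auto simp: abs_if)
    then show ?thesis unfolding D by linarith
  qed
  have D0: "tendsto_zero_in_prob M D"
    unfolding tendsto_zero_in_prob_def
  proof (intro allI impI)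
    fix \<epsilon> :: real assume \<epsilon>: "0 < \<epsilon>"
    show "(\<lambda>n. outer_measure_of (M n) {y \<in> space (M n). \<epsilon> < \<bar>D n y\<bar>}) \<longlonglongrightarrow> 0"
      by (rule tendsto_zero_in_prob_subset[where a="\<epsilon> / 2" and b="\<epsilon> / 2",
            OF rescaled_quantile_tendsto_in_prob[OF post V u z \<alpha>(1) conv] _ close[unfolded small_o_P_root_n_def]])
        (use \<epsilon> in \<open>auto intro!: always_eventually dest!: order_less_le_trans[OF _ Dle]\<close>)
  qed
  have "D n \<in> borel_measurable (M n)" for n
    unfolding D_def by measurable
  then have "(\<lambda>n. measure (M n) {y \<in> space (M n). sqrt (real n) * (h n y - t) + D n y < - z}) \<longlonglongrightarrow> cdf ?N (- z)"
    by (intro slutsky_cdf prob normal isCont_cdf_centered_normal V D0) simp_all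
  also have "cdf ?N (- z) = 1 - u"
    using cdf_centered_normal_uminus[OF V, of z] z by simp
  finally show ?thesis
  proof (rule Lim_transform_eventually)
    show "eventually (\<lambda>n. measure (M n) {y \<in> space (M n). sqrt (real n) * (h n y - t) + D n y < - z}
        = measure (M n) {y \<in> space (M n). ?E n y < t}) sequentially"
      using eventually_gt_at_top[of 0]
    proof eventually_elim
      case (elim n)
      \<comment> \<open>By definition of \<open>D\<close> the left side plus \<open>z\<close> equals
        \<open>sqrt (real n) * (?E n y - t)\<close>; for positive \<open>n\<close> the factor
        cancels.\<close>
      have "sqrt (real n) * (h n y - t) + D n y < - z \<longleftrightarrow> sqrt (real n) * (?E n y - t) < sqrt (real n) * 0" for y
        by (simp add: D_def algebra_simps)
      also have "\<dots> y \<longleftrightarrow> ?E n y < t" for y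
        using elim by (subst mult_less_cancel_left_pos) auto
      finally show ?case by simp
    qed
  qed
qed

text \<open>Since the interval is open on the left and closed on the right, coverage means that the
  lower endpoint is below \<open>t\<close> and the upper one is not: a difference of two events of
  the same strict form.\<close>

lemma rescaled_interval_coverage:
  assumes prob: "\<And>n. prob_space (M n)"
    and post: "\<And>n. posterior_of_functional p prior n (M n) \<psi>"
    and V: "0 < V" and \<delta>: "0 < \<delta>" "\<delta> < 1"
    and \<alpha>: "\<And>n. 0 < \<alpha> n" "\<And>n. \<alpha> n \<le> 1"
    and h: "\<And>n. h n \<in> borel_measurable (M n)"
    and m: "\<And>n. m n \<in> borel_measurable (M n)"
    and conv: "weak_conv_in_prob M
      (\<lambda>n y. posterior_law p prior \<alpha> n y (\<lambda>\<eta>. sqrt (real n * \<alpha> n) * (\<psi> \<eta> - h n y))) (centered_normal V)"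
    and normal: "weak_conv_m (\<lambda>n. distr (M n) borel (\<lambda>y. sqrt (real n) * (h n y - t))) (centered_normal V)"
    and close: "small_o_P_root_n M (\<lambda>n y. m n y - h n y)"
  shows "(\<lambda>n. measure (M n) {y \<in> space (M n).
      t \<in> rescaled_interval \<delta> (\<alpha> n) (posterior_law p prior \<alpha> n y \<psi>) (m n y)}) \<longlonglongrightarrow> 1 - \<delta>"
proof -
  let ?a = "\<lambda>u n y. quantile (posterior_law p prior \<alpha> n y \<psi>) u"
  let ?B = "\<lambda>u n. {y \<in> space (M n). sqrt (\<alpha> n) * (?a u n y - m n y) + m n y < t}"
  have lim: "(\<lambda>n. measure (M n) (?B u n)) \<longlonglongrightarrow> 1 - u" if "0 < u" "u < 1" for u
    by (rule rescaled_endpoint_coverage[OF prob post V that \<alpha> h m conv normal close])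
  have "measure (M n) {y \<in> space (M n).
      t \<in> rescaled_interval \<delta> (\<alpha> n) (posterior_law p prior \<alpha> n y \<psi>) (m n y)}
    = measure (M n) (?B (\<delta> / 2) n) - measure (M n) (?B (1 - \<delta> / 2) n)" for n
  proof -
    interpret prob_space "M n" by (rule prob)
    interpret posterior_of_functional p prior n "M n" \<psi> \<alpha> by (rule post)
    have "?B u n \<in> sets (M n)" if "0 < u" "u < 1" for u
    proof -
      note [measurable] = quantile_Q_measurable[OF that] m
      show ?thesis by measurable
    qed
    then have meas: "?B (\<delta> / 2) n \<in> sets (M n)" "?B (1 - \<delta> / 2) n \<in> sets (M n)"
      using \<delta> by simp_all
    have "sqrt (\<alpha> n) * (?a (\<delta> / 2) n y - m n y) \<le> sqrt (\<alpha> n) * (?a (1 - \<delta> / 2) n y - m n y)"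
      if "y \<in> space (M n)" for y
      using quantile_mono_Q[OF that, of "\<delta> / 2" "1 - \<delta> / 2"] \<delta> \<alpha>[of n] by (intro mult_left_mono) auto
    then have sub: "?B (1 - \<delta> / 2) n \<subseteq> ?B (\<delta> / 2) n" by force
    have "{y \<in> space (M n). t \<in> rescaled_interval \<delta> (\<alpha> n) (posterior_law p prior \<alpha> n y \<psi>) (m n y)}
        = ?B (\<delta> / 2) n - ?B (1 - \<delta> / 2) n"
      by (auto simp: rescaled_interval_def)
    then show ?thesis by (simp add: finite_measure_Diff[OF meas sub])
  qed
  \<comment> \<open>The endpoint limits are \<open>1 - \<delta> / 2\<close> and
    \<open>\<delta> / 2\<close>.\<close>
  moreover have "(\<lambda>n. measure (M n) (?B (\<delta> / 2) n) - measure (M n) (?B (1 - \<delta> / 2) n))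
      \<longlonglongrightarrow> (1 - \<delta> / 2) - (1 - (1 - \<delta> / 2))"
    using \<delta> by (intro tendsto_diff lim) auto
  ultimately show ?thesis by simp
qed

lemma posterior_median_close:
  assumes post: "\<And>n. posterior_of_functional p prior n (M n) \<psi>"
    and V: "0 < V" and \<alpha>: "0 < \<alpha>"
    and conv: "weak_conv_in_prob M
      (\<lambda>n y. posterior_law p prior (\<lambda>_. \<alpha>) n y (\<lambda>\<eta>. sqrt (real n * \<alpha>) * (\<psi> \<eta> - h n y))) (centered_normal V)"
  shows "small_o_P_root_n M (\<lambda>n y. quantile (posterior_law p prior (\<lambda>_. \<alpha>) n y \<psi>) (1 / 2) - h n y)"
proof -
  let ?A = "\<lambda>n y. quantile (posterior_law p prior (\<lambda>_. \<alpha>) n y \<psi>) (1 / 2) - h n y"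
  \<comment> \<open>Reflection at 0 gives F(0) = 1 - F(0), so the limiting median is 0.\<close>
  have "cdf (centered_normal V) 0 = 1 / 2"
    using cdf_centered_normal_uminus[OF V, of 0] by simp
  then have *: "tendsto_zero_in_prob M (\<lambda>n y. sqrt (real n * \<alpha>) * ?A n y - 0)"
    using conv \<alpha> by (intro rescaled_quantile_tendsto_in_prob[OF post V]) auto
  show ?thesis
    unfolding small_o_P_root_n_def tendsto_zero_in_prob_def
  proof (intro allI impI)
    fix \<epsilon> :: real assume "0 < \<epsilon>"
    \<comment> \<open>With \<open>\<alpha>\<close> fixed, passing from scale
      \<open>sqrt (real n * \<alpha>)\<close> to \<open>sqrt (real n)\<close> only changes the
      threshold by a constant factor.\<close>
    then have "0 < sqrt \<alpha> * \<epsilon>" using \<alpha> by simp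
    moreover have "sqrt \<alpha> * \<epsilon> < \<bar>sqrt (real n * \<alpha>) * ?A n y - 0\<bar>" if "\<epsilon> < \<bar>sqrt (real n) * ?A n y\<bar>" for n y
      using mult_strict_left_mono[OF that, of "sqrt \<alpha>"] \<alpha> by (simp add: real_sqrt_mult abs_mult ac_simps)
    ultimately show "(\<lambda>n. outer_measure_of (M n) {y \<in> space (M n). \<epsilon> < \<bar>sqrt (real n) * ?A n y\<bar>}) \<longlonglongrightarrow> 0"
      by (intro tendsto_zero_in_prob_subset[OF * _ *]) (auto intro!: always_eventually)
  qed
qed

section \<open>Coverage for varying exponents and for a fixed exponent with the posterior
  median\<close>

theorem theorem3p1:
  fixes S :: "'e::real_vector set"
    and P :: "nat \<Rightarrow> 'e \<Rightarrow> 'y measure"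
    and \<mu> :: "nat \<Rightarrow> 'y measure"
    and p :: "nat \<Rightarrow> 'e \<Rightarrow> 'y \<Rightarrow> real"
    and prior :: "nat \<Rightarrow> 'e measure"
    and \<eta>0 :: 'e
    and \<psi> :: "'e \<Rightarrow> real"
    and H :: "'e set"
    and L :: "'e \<Rightarrow> 'e \<Rightarrow> real"
    and W :: "nat \<Rightarrow> 'e \<Rightarrow> 'y \<Rightarrow> real"
    and R :: "nat \<Rightarrow> 'e \<Rightarrow> 'e \<Rightarrow> 'y \<Rightarrow> ereal"
    and \<psi>0 :: 'e
    and r :: "'e \<Rightarrow> 'e \<Rightarrow> real"
    and V \<delta> :: real
    and psihat :: "nat \<Rightarrow> 'y \<Rightarrow> real"
  assumes experiments: "dominated_experiments S P \<mu> p"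
    and true_parameter: "\<eta>0 \<in> S"
    and prior_on_S: "\<And>n. prob_space (prior n)" "\<And>n. space (prior n) = S"
    and joint_measurability: "\<And>n. (\<lambda>(y, \<eta>). p n \<eta> y) \<in> borel_measurable (\<mu> n \<Otimes>\<^sub>M prior n)"
    and functional_measurable: "\<And>n. \<psi> \<in> borel_measurable (prior n)"
    and LAN: "LAN_expansion S P p \<eta>0 H L W R"
    and functional_expansion: "\<psi>0 \<in> H" "\<And>\<eta>. \<eta> \<in> S \<Longrightarrow> \<psi> \<eta> - \<psi> \<eta>0 = L \<psi>0 (\<eta> - \<eta>0) + r \<eta> \<eta>0"
    and V: "V = L \<psi>0 \<psi>0" "V > 0"
    and \<delta>: "0 < \<delta>" "\<delta> < 1"
    and psihat_measurable: "\<And>n. psihat n \<in> borel_measurable (\<mu> n)"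
    and psihat_efficient: "linear_efficient P \<eta>0 \<psi> W \<psi>0 psihat"
    and psihat_normal: "weak_conv_m
        (\<lambda>n. distr (P n \<eta>0) borel (\<lambda>y. sqrt (real n) * (psihat n y - \<psi> \<eta>0))) (centered_normal V)"
  shows
    "(\<forall>\<alpha> :: nat \<Rightarrow> real. \<forall>T :: nat \<Rightarrow> real measure \<Rightarrow> real. \<forall>psibar :: nat \<Rightarrow> 'y \<Rightarrow> real.
        (\<forall>n. 0 < \<alpha> n \<and> \<alpha> n < 1) \<longrightarrow>
        filterlim (\<lambda>n. real n * \<alpha> n) at_top sequentially \<longrightarrow>
        weak_conv_in_prob (\<lambda>n. P n \<eta>0)
          (\<lambda>n y. posterior_law p prior \<alpha> n y (\<lambda>\<eta>. sqrt (real n * \<alpha> n) * (\<psi> \<eta> - psihat n y)))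
          (centered_normal V) \<longrightarrow>
        (\<forall>n. psibar n \<in> borel_measurable (\<mu> n)) \<longrightarrow>
        (\<forall>n. \<forall>y \<in> space (\<mu> n). psibar n y = T n (posterior_law p prior \<alpha> n y \<psi>)) \<longrightarrow>
        small_o_P_root_n (\<lambda>n. P n \<eta>0) (\<lambda>n y. psibar n y - psihat n y) \<longrightarrow>
        (\<lambda>n. measure (P n \<eta>0) {y \<in> space (P n \<eta>0).
            \<psi> \<eta>0 \<in> rescaled_interval \<delta> (\<alpha> n) (posterior_law p prior \<alpha> n y \<psi>) (psibar n y)})
          \<longlonglongrightarrow> 1 - \<delta>)
     \<and>
     (\<forall>\<alpha> :: real.
        0 < \<alpha> \<longrightarrow> \<alpha> \<le> 1 \<longrightarrow>
        weak_conv_in_prob (\<lambda>n. P n \<eta>0)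
          (\<lambda>n y. posterior_law p prior (\<lambda>_. \<alpha>) n y (\<lambda>\<eta>. sqrt (real n * \<alpha>) * (\<psi> \<eta> - psihat n y)))
          (centered_normal V) \<longrightarrow>
        small_o_P_root_n (\<lambda>n. P n \<eta>0)
          (\<lambda>n y. quantile (posterior_law p prior (\<lambda>_. \<alpha>) n y \<psi>) (1 / 2) - psihat n y) \<and>
        (\<lambda>n. measure (P n \<eta>0) {y \<in> space (P n \<eta>0).
            \<psi> \<eta>0 \<in> rescaled_interval \<delta> \<alpha> (posterior_law p prior (\<lambda>_. \<alpha>) n y \<psi>)
              (quantile (posterior_law p prior (\<lambda>_. \<alpha>) n y \<psi>) (1 / 2))})
          \<longlonglongrightarrow> 1 - \<delta>)"
proof -
  let ?M = "\<lambda>n. P n \<eta>0"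
  have dens: "P n \<eta>0 = density (\<mu> n) (\<lambda>y. ennreal (p n \<eta>0 y))" and prob: "prob_space (P n \<eta>0)" for n
    using experiments true_parameter unfolding dominated_experiments_def by blast+
  \<comment> \<open>The true law has a density, hence the sigma-algebra of the dominating measure,
    and measurability carries over.\<close>
  have sets: "sets (P n \<eta>0) = sets (\<mu> n)" for n
    by (simp add: dens)
  have h: "psihat n \<in> borel_measurable (P n \<eta>0)" for n
    using psihat_measurable[of n] by (simp add: measurable_cong_sets[OF sets refl])
  have post: "posterior_of_functional p prior n (P n \<eta>0) \<psi>" for n
  proof (rule posterior_of_functional.intro)
    interpret prob_space "prior n" by (rule prior_on_S)
    show "sigma_finite_measure (prior n)" by unfold_locales
    show "(\<lambda>(y, \<eta>). p n \<eta> y) \<in> borel_measurable (P n \<eta>0 \<Otimes>\<^sub>M prior n)"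
      using joint_measurability[of n]
      by (simp add: measurable_cong_sets[OF sets_pair_measure_cong[OF sets refl] refl])
  qed (rule functional_measurable)
  show ?thesis
  proof (intro conjI allI impI)
    fix \<alpha> :: "nat \<Rightarrow> real" and T :: "nat \<Rightarrow> real measure \<Rightarrow> real" and psibar :: "nat \<Rightarrow> 'y \<Rightarrow> real"
    assume "\<forall>n. 0 < \<alpha> n \<and> \<alpha> n < 1"
      and conv: "weak_conv_in_prob ?M
          (\<lambda>n y. posterior_law p prior \<alpha> n y (\<lambda>\<eta>. sqrt (real n * \<alpha> n) * (\<psi> \<eta> - psihat n y)))
          (centered_normal V)"
      and psibar: "\<forall>n. psibar n \<in> borel_measurable (\<mu> n)"
      and close: "small_o_P_root_n ?M (\<lambda>n y. psibar n y - psihat n y)"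
    then have \<alpha>: "0 < \<alpha> n" "\<alpha> n \<le> 1" for n by (auto intro: less_imp_le)
    have m: "psibar n \<in> borel_measurable (P n \<eta>0)" for n
      using psibar by (simp add: measurable_cong_sets[OF sets refl])
    show "(\<lambda>n. measure (P n \<eta>0) {y \<in> space (P n \<eta>0).
            \<psi> \<eta>0 \<in> rescaled_interval \<delta> (\<alpha> n) (posterior_law p prior \<alpha> n y \<psi>) (psibar n y)})
          \<longlonglongrightarrow> 1 - \<delta>"
      by (rule rescaled_interval_coverage[OF prob post V(2) \<delta> \<alpha> h m conv psihat_normal close])
  next
    fix \<alpha> :: real
    assume \<alpha>: "0 < \<alpha>" "\<alpha> \<le> 1"
      and conv: "weak_conv_in_prob ?M
          (\<lambda>n y. posterior_law p prior (\<lambda>_. \<alpha>) n y (\<lambda>\<eta>. sqrt (real n * \<alpha>) * (\<psi> \<eta> - psihat n y)))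
          (centered_normal V)"
    let ?med = "\<lambda>n y. quantile (posterior_law p prior (\<lambda>_. \<alpha>) n y \<psi>) (1 / 2)"
    show close: "small_o_P_root_n ?M (\<lambda>n y. ?med n y - psihat n y)"
      by (rule posterior_median_close[OF post V(2) \<alpha>(1) conv])
    \<comment> \<open>The median now plays the part of the centering estimator, so its measurability
      in the data has to be supplied.\<close>
    have m: "?med n \<in> borel_measurable (P n \<eta>0)" for n
      by (rule posterior_of_functional.quantile_Q_measurable[OF post]) auto
    show "(\<lambda>n. measure (P n \<eta>0) {y \<in> space (P n \<eta>0).
            \<psi> \<eta>0 \<in> rescaled_interval \<delta> \<alpha> (posterior_law p prior (\<lambda>_. \<alpha>) n y \<psi>) (?med n y)})
          \<longlonglongrightarrow> 1 - \<delta>"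
      by (rule rescaled_interval_coverage[OF prob post V(2) \<delta> \<alpha> h m conv psihat_normal close])
  qed
qed

end
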